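(* Let $\mathbb{F}$ be a finite field, $H$ a nonempty subset of $\mathbb{F}$, and $\gamma:=\sum_{\alpha\in H}\alpha$. For every polynomial $P\in\mathbb{F}[X_1,\dots,X_m]$ that is multilinear (individual degree at most $1$), $$\sum_{\vec\alpha\in H^m}P(\vec\alpha)=\begin{cases}P\big(\tfrac{\gamma}{|H|},\dots,\tfrac{\gamma}{|H|}\big)\cdot|H|^m & \text{if }\mathrm{char}(\mathbb{F})\nmid|H|,\\ \kappa\cdot\gamma^m & \text{if }\mathrm{char}(\mathbb{F})\mid|H|,\end{cases}$$ where $\kappa$ is the coefficient of $X_1\cdots X_m$ in $P$. *)

theory Defs
  imports
    "HOL-Computational_Algebra.Computational_Algebra"
    "HOL-Library.Poly_Mapping"
    "HOL-Library.FuncSet"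
begin

text \<open>
  A polynomial is a finitely supported map from exponent vectors to coefficients, so the library's
  convolution product is polynomial multiplication. Variables are indexed by all natural numbers;
  \<open>polynomials m\<close> is the subset \<open>F[X\<^sub>1, \<dots>, X\<^sub>m]\<close>, with \<open>X\<^sub>1, \<dots>, X\<^sub>m\<close> indexed by \<open>0, \<dots>, m - 1\<close>.
\<close>

type_synonym 'a mpolynomial = "(nat \<Rightarrow>\<^sub>0 nat) \<Rightarrow>\<^sub>0 'a"

definition polynomials :: "nat \<Rightarrow> 'a::zero mpolynomial set" where
  "polynomials m = {P. \<forall>e \<in> Poly_Mapping.keys P. Poly_Mapping.keys e \<subseteq> {..<m}}"

definition mpeval :: "'a::comm_semiring_1 mpolynomial \<Rightarrow> (nat \<Rightarrow> 'a) \<Rightarrow> 'a" where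
  "mpeval P x =
     (\<Sum>e \<in> Poly_Mapping.keys P. Poly_Mapping.lookup P e *
        (\<Prod>i \<in> Poly_Mapping.keys e. x i ^ Poly_Mapping.lookup e i))"

text \<open>The degree in a single variable (the zero polynomial gets degree 0).\<close>

definition indiv_degree :: "nat \<Rightarrow> 'a::zero mpolynomial \<Rightarrow> nat" where
  "indiv_degree i P = Max (insert 0 ((\<lambda>e. Poly_Mapping.lookup e i) ` Poly_Mapping.keys P))"

definition multilinear :: "'a::zero mpolynomial \<Rightarrow> bool" where
  "multilinear P \<longleftrightarrow> (\<forall>i. indiv_degree i P \<le> 1)"

text \<open>The exponent vector of \<open>X\<^sub>1 \<cdots> X\<^sub>m\<close>.\<close>

definition full_monomial :: "nat \<Rightarrow> (nat \<Rightarrow>\<^sub>0 nat)" where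
  "full_monomial m = (\<Sum>i<m. Poly_Mapping.single i 1)"

end

theory Submission imports Defs begin

text \<open>
  By linearity it suffices to treat a monomial whose set of variables is \<open>K \<subseteq> {..<m}\<close>. Its sum over
  \<open>H\<^sup>m\<close> factors into one-variable sums and equals \<open>\<gamma> ^ |K| * |H| ^ (m - |K|)\<close>. If \<open>|H|\<close> is invertible,
  this is the value of the monomial at \<open>\<gamma> / |H|\<close> times \<open>|H| ^ m\<close>; if \<open>|H| = 0\<close> in the field, only
  the monomial with \<open>K = {..<m}\<close> survives.
\<close>

lemma lookup_full_monomial:
  "Poly_Mapping.lookup (full_monomial m) i = (if i < m then 1 else 0)"
proof -
  have "Poly_Mapping.lookup (full_monomial m) i = (\<Sum>j<m. if j = i then 1 else 0)"
    by (simp add: full_monomial_def lookup_sum lookup_single when_def)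
  then show ?thesis by simp
qed

lemma keys_full_monomial: "Poly_Mapping.keys (full_monomial m) = {..<m}"
  by (auto simp: in_keys_iff lookup_full_monomial split: if_splits)

lemma multilinear_lookup_le_1:
  assumes "multilinear P" "e \<in> Poly_Mapping.keys P"
  shows "Poly_Mapping.lookup e i \<le> 1"
proof -
  have "Poly_Mapping.lookup e i \<le> indiv_degree i P"
    unfolding indiv_degree_def using assms(2) by (intro Max_ge) auto
  also have "\<dots> \<le> 1"
    using assms(1) by (simp add: multilinear_def)
  finally show ?thesis .
qed

lemma multilinear_lookup_key:
  assumes "multilinear P" "e \<in> Poly_Mapping.keys P" "i \<in> Poly_Mapping.keys e"
  shows "Poly_Mapping.lookup e i = 1"
  using multilinear_lookup_le_1[OF assms(1,2), of i] assms(3) by (simp add: in_keys_iff)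

text \<open>Multilinearity forces every exponent to be 0 or 1, so a monomial of \<open>P\<close> is
  determined by its set of variables. This singles out the one term that survives when
  \<open>card H\<close> vanishes in the field.\<close>

lemma multilinear_key_eq_full_monomial:
  assumes "multilinear P" "e \<in> Poly_Mapping.keys P" "Poly_Mapping.keys e = {..<m}"
  shows "e = full_monomial m"
proof (rule poly_mapping_eqI)
  fix i
  show "Poly_Mapping.lookup e i = Poly_Mapping.lookup (full_monomial m) i"
    using multilinear_lookup_key[OF assms(1,2), of i] assms(3)
    by (metis in_keys_iff lessThan_iff lookup_full_monomial)
qed

lemma mpeval_multilinear:
  assumes "multilinear P"
  shows "mpeval P x = (\<Sum>e\<in>Poly_Mapping.keys P. Poly_Mapping.lookup P e * (\<Prod>i\<in>Poly_Mapping.keys e. x i))"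
  unfolding mpeval_def
  by (intro sum.cong refl arg_cong2[where f = "(*)"] prod.cong)
     (simp add: multilinear_lookup_key[OF assms])

text \<open>The coordinates of \<open>x\<close> vary independently, so the sum factors over
  \<open>A\<close>: an index in \<open>K\<close> contributes the sum of \<open>H\<close>, and a free
  index contributes \<open>card H\<close>.\<close>

lemma sum_PiE_prod_subset:
  fixes H :: "'a::comm_semiring_1 set"
  assumes "finite A" "finite H" "K \<subseteq> A"
  shows "(\<Sum>x \<in> A \<rightarrow>\<^sub>E H. \<Prod>i\<in>K. x i) = (\<Sum>h\<in>H. h) ^ card K * of_nat (card H) ^ (card A - card K)"
proof -
  have fK: "finite K" using assms finite_subset by blast
  \<comment> \<open>Padding with factors 1 makes the product range over all of \<open>A\<close>, as
    distributivity over \<open>A \<rightarrow>\<^sub>E H\<close> requires.\<close>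
  have "(\<Sum>x \<in> A \<rightarrow>\<^sub>E H. \<Prod>i\<in>K. x i) = (\<Sum>x \<in> A \<rightarrow>\<^sub>E H. \<Prod>i\<in>A. if i \<in> K then x i else 1)"
    using assms by (simp add: prod.If_cases Int_absorb1)
  also have "\<dots> = (\<Prod>i\<in>A. \<Sum>h\<in>H. if i \<in> K then h else 1)"
    using assms by (simp add: prod_sum_PiE)
  also have "\<dots> = (\<Prod>i\<in>A. if i \<in> K then \<Sum>h\<in>H. h else of_nat (card H))"
    by (intro prod.cong) auto
  also have "\<dots> = (\<Sum>h\<in>H. h) ^ card K * of_nat (card H) ^ card (A - K)"
    using assms by (simp add: prod.If_cases Int_absorb1 Diff_eq)
  finally show ?thesis
    using assms fK by (simp add: card_Diff_subset)
qed

theorem theoremA3: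
  fixes H :: "'a::{field,finite} set"
    and \<gamma> :: 'a
    and m :: nat
    and P :: "'a mpolynomial"
  assumes "H \<noteq> {}"
    and "\<gamma> = (\<Sum>\<alpha>\<in>H. \<alpha>)"
    and "P \<in> polynomials m"
    and "multilinear P"
  shows "(\<Sum>\<alpha> \<in> {..<m} \<rightarrow>\<^sub>E H. mpeval P \<alpha>) =
    (if \<not> CHAR('a) dvd card H
     then mpeval P (\<lambda>_. \<gamma> / of_nat (card H)) * of_nat (card H) ^ m
     else Poly_Mapping.lookup P (full_monomial m) * \<gamma> ^ m)"
proof -
  define h :: 'a where "h = of_nat (card H)"
  let ?c = "\<lambda>e. card (Poly_Mapping.keys e)"
  have keys_sub: "Poly_Mapping.keys e \<subseteq> {..<m}" if "e \<in> Poly_Mapping.keys P" for e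
    using assms(3) that by (auto simp: polynomials_def)
  \<comment> \<open>With this bound the truncated difference \<open>m - ?c e\<close> is a true one,
    so \<open>h ^ (m - ?c e)\<close> is \<open>h ^ m / h ^ ?c e\<close> once \<open>h\<close> is
    nonzero.\<close>
  have c_le: "?c e \<le> m" if "e \<in> Poly_Mapping.keys P" for e
    using card_mono[OF _ keys_sub[OF that]] by simp
  have "(\<Sum>\<alpha> \<in> {..<m} \<rightarrow>\<^sub>E H. mpeval P \<alpha>) =
      (\<Sum>e\<in>Poly_Mapping.keys P. Poly_Mapping.lookup P e *
        (\<Sum>\<alpha> \<in> {..<m} \<rightarrow>\<^sub>E H. \<Prod>i\<in>Poly_Mapping.keys e. \<alpha> i))"
    unfolding mpeval_multilinear[OF assms(4)] sum_distrib_left by (rule sum.swap)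
  also have "\<dots> = (\<Sum>e\<in>Poly_Mapping.keys P. Poly_Mapping.lookup P e * (\<gamma> ^ ?c e * h ^ (m - ?c e)))"
    using keys_sub by (intro sum.cong) (simp_all add: sum_PiE_prod_subset assms(2) h_def)
  finally have total: "(\<Sum>\<alpha> \<in> {..<m} \<rightarrow>\<^sub>E H. mpeval P \<alpha>) =
      (\<Sum>e\<in>Poly_Mapping.keys P. Poly_Mapping.lookup P e * (\<gamma> ^ ?c e * h ^ (m - ?c e)))" .
  show ?thesis
  proof (cases "CHAR('a) dvd card H")
    case False
    then have "h \<noteq> 0"
      by (simp add: h_def of_nat_eq_0_iff_char_dvd)
    then have "\<gamma> ^ ?c e * h ^ (m - ?c e) = (\<gamma> / h) ^ ?c e * h ^ m" if "e \<in> Poly_Mapping.keys P" for e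
      using c_le[OF that] by (simp add: power_diff power_divide)
    then show ?thesis
      using False unfolding total unfolding mpeval_multilinear[OF assms(4)]
      by (simp add: sum_distrib_right mult.assoc flip: h_def)
  next
    case True
    then have "h = 0"
      by (simp add: h_def of_nat_eq_0_iff_char_dvd)
    have "Poly_Mapping.lookup P e * (\<gamma> ^ ?c e * h ^ (m - ?c e)) =
        (if e = full_monomial m then Poly_Mapping.lookup P e * \<gamma> ^ m else 0)"
      if e: "e \<in> Poly_Mapping.keys P" for e
    proof (cases "e = full_monomial m")
      case True
      \<comment> \<open>Here \<open>?c e = m\<close>, so the factor \<open>h ^ 0\<close> is 1 even
        though \<open>h = 0\<close>.\<close>
      then show ?thesis by (simp add: keys_full_monomial)
    next
      case False
      then have "Poly_Mapping.keys e \<subset> {..<m}"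
        using multilinear_key_eq_full_monomial[OF assms(4) e] keys_sub[OF e] by blast
      \<comment> \<open>A missing variable leaves a positive power of \<open>h = 0\<close>, which
        kills the term.\<close>
      then have "?c e < m"
        using psubset_card_mono[of "{..<m}"] by simp
      with False \<open>h = 0\<close> show ?thesis by simp
    qed
    then have "(\<Sum>\<alpha> \<in> {..<m} \<rightarrow>\<^sub>E H. mpeval P \<alpha>) =
        (if full_monomial m \<in> Poly_Mapping.keys P
         then Poly_Mapping.lookup P (full_monomial m) * \<gamma> ^ m else 0)"
      unfolding total by simp
    \<comment> \<open>If \<open>full_monomial m\<close> is not a key, its coefficient is 0 and both
      branches agree.\<close>
    with True show ?thesis by (simp add: in_keys_iff)
  qed
qed

end
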